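(* For every instance $\mathcal I$ of the heterogeneous data-center right-sizing problem (with time-dependent operating cost functions), the schedule $X^{\mathcal B}$ produced by the online algorithm $\mathcal B$ described below satisfies $$C(X^{\mathcal B})\le\big(2d+1+c(\mathcal I)\big)\cdot C(X^\ast),\qquad c(\mathcal I)=\sum_{j=1}^d\max_{t\in[T]}\frac{l_{t,j}}{\beta_j},$$ where $l_{t,j}=f_{t,j}(0)$ and $X^\ast$ is an optimal schedule for $\mathcal I$; i.e. $\mathcal B$ is $(2d+1+c(\mathcal I))$-competitive.
   Context: Notation: $[k]=\{1,\dots,k\}$, $[k]_0=\{0,\dots,k\}$, $(x)^+=\max(x,0)$. Problem: An instance $\mathcal I$ consists of $T\in\mathbb N$ time slots, $d\in\mathbb N$ server types, numbers $m_j\in\mathbb N$ of servers of type $j$, switching costs $\beta_j>0$, capacities $z^{\max}_j>0$, job volumes $\lambda_t\ge0$, and functions $f_{t,j}$ convex, increasing, non-negative on $[0,z^{\max}_j]$ (value $+\infty$ above $z^{\max}_j$). For $x\in\mathbb N_0$, $z\in[0,1]$: $g_{t,j}(x,z)=xf_{t,j}(\lambda_tz/x)$ if $x>0$, $g_{t,j}(0,z)=\infty$ if $\lambda_tz>0$, $=0$ if $\lambda_tz=0$; $\mathcal Z=\{z\in[0,1]^d:\sum_jz_j=1\}$; $g_t(\vec x)=\min_{z\in\mathcal Z}\sum_jg_{t,j}(x_j,z_j)$. A schedule $X=(\vec x_1,\dots,\vec x_T)$ has $x_{t,j}\in[m_j]_0$, $\vec x_0=\vec x_{T+1}=\vec0$,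 and is feasible if $\sum_jx_{t,j}z^{\max}_j\ge\lambda_t$ for all $t$; $C(X)=\sum_{t=1}^T(g_t(\vec x_t)+\sum_j\beta_j(x_{t,j}-x_{t-1,j})^+)$. Online setting: at slot $t$ the algorithm learns $\lambda_t$ and $f_{t,\cdot}$ and fixes $\vec x_t$. Truncated instances: $\mathcal I^t$ is the instance restricted to slots $1,\dots,t$ (final state $\vec 0$ at $t+1$), and $\hat X^t$ (entries $\hat x^t_{u,j}$) is an optimal schedule for $\mathcal I^t$. Algorithm $\mathcal B$: initialize $w_{t,j}=0$ for all $t,j$ and $x^{\mathcal B}_{0,j}=0$. For $t=1,\dots,T$: compute $\hat X^t$; for each $j\in[d]$ let $W_{t,j}=\{u\in[t-1]:\sum_{v=u+1}^{t-1}l_{v,j}\le\beta_j<\sum_{v=u+1}^{t}l_{v,j}\}$; set $x^{\mathcal B}_{t,j}:=x^{\mathcal B}_{t-1,j}-\sum_{u\in W_{t,j}}w_{u,j}$ (servers powered up at slots $u\in W_{t,j}$ are powered down); if $x^{\mathcal B}_{t,j}\le\hat x^t_{t,j}$, set $w_{t,j}:=\hat x^t_{t,j}-x^{\mathcal B}_{t,j}$ and $x^{\mathcal B}_{t,j}:=\hat x^t_{t,j}$. *)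

theory Defs
  imports "HOL-Analysis.Analysis"
begin

text \<open>Time slots are indexed by \<open>1..T\<close> and server types by \<open>1..d\<close>; values of the fields
  outside these ranges are irrelevant.\<close>

record dc_instance =
  slots :: nat
  types :: nat
  servers :: "nat \<Rightarrow> nat"
  switch_cost :: "nat \<Rightarrow> real"
  capacity :: "nat \<Rightarrow> real"
  volume :: "nat \<Rightarrow> real"
  op_fun :: "nat \<Rightarrow> nat \<Rightarrow> real \<Rightarrow> real"

text \<open>\<open>op_fun I t j\<close> is only meaningful on \<open>{0..capacity I j}\<close>; the value \<open>\<infinity>\<close> above the
  capacity is supplied by \<open>op_cost\<close>.\<close>

definition valid_instance :: "dc_instance \<Rightarrow> bool" where
  "valid_instance I \<longleftrightarrow>
     slots I \<ge> 1 \<and> types I \<ge> 1 \<and>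
     (\<forall>j\<in>{1..types I}. servers I j \<ge> 1 \<and> switch_cost I j > 0 \<and> capacity I j > 0) \<and>
     (\<forall>t\<in>{1..slots I}. volume I t \<ge> 0) \<and>
     (\<forall>t\<in>{1..slots I}. \<forall>j\<in>{1..types I}.
        convex_on {0..capacity I j} (op_fun I t j) \<and>
        mono_on {0..capacity I j} (op_fun I t j) \<and>
        (\<forall>z\<in>{0..capacity I j}. op_fun I t j z \<ge> 0))"

definition op_cost :: "dc_instance \<Rightarrow> nat \<Rightarrow> nat \<Rightarrow> real \<Rightarrow> ereal" where
  "op_cost I t j z = (if z \<le> capacity I j then ereal (op_fun I t j z) else \<infinity>)"

definition idle_cost :: "dc_instance \<Rightarrow> nat \<Rightarrow> nat \<Rightarrow> real" where
  "idle_cost I t j = op_fun I t j 0"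

definition type_cost :: "dc_instance \<Rightarrow> nat \<Rightarrow> nat \<Rightarrow> int \<Rightarrow> real \<Rightarrow> ereal" where
  "type_cost I t j x z =
     (if x > 0 then ereal (real_of_int x) * op_cost I t j (volume I t * z / real_of_int x)
      else if volume I t * z > 0 then \<infinity> else 0)"

definition distributions :: "dc_instance \<Rightarrow> (nat \<Rightarrow> real) set" where
  "distributions I =
     {z. (\<forall>j\<in>{1..types I}. 0 \<le> z j \<and> z j \<le> 1) \<and> (\<Sum>j=1..types I. z j) = 1}"

text \<open>The infimum is the minimum whenever the latter exists; it may fail to be attained only if
  some operating cost function jumps at the right end of its domain.\<close>

definition slot_cost :: "dc_instance \<Rightarrow> nat \<Rightarrow> (nat \<Rightarrow> int) \<Rightarrow> ereal" where
  "slot_cost I t x = (INF z\<in>distributions I. \<Sum>j=1..types I. type_cost I t j (x j) (z j))"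

text \<open>A schedule maps slot and type to a number of active servers. The numbers are of type
  \<open>int\<close> so that no subtraction is truncated.\<close>

type_synonym schedule = "nat \<Rightarrow> nat \<Rightarrow> int"

definition is_schedule :: "dc_instance \<Rightarrow> schedule \<Rightarrow> bool" where
  "is_schedule I X \<longleftrightarrow>
     (\<forall>t\<in>{1..slots I}. \<forall>j\<in>{1..types I}. 0 \<le> X t j \<and> X t j \<le> int (servers I j)) \<and>
     (\<forall>j\<in>{1..types I}. X 0 j = 0 \<and> X (slots I + 1) j = 0)"

definition feasible :: "dc_instance \<Rightarrow> schedule \<Rightarrow> bool" where
  "feasible I X \<longleftrightarrow> is_schedule I X \<and>
     (\<forall>t\<in>{1..slots I}. (\<Sum>j=1..types I. real_of_int (X t j) * capacity I j) \<ge> volume I t)"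

definition cost :: "dc_instance \<Rightarrow> schedule \<Rightarrow> ereal" where
  "cost I X =
     (\<Sum>t=1..slots I. slot_cost I t (X t) +
        ereal (\<Sum>j=1..types I. switch_cost I j * real_of_int (max (X t j - X (t - 1) j) 0)))"

definition optimal :: "dc_instance \<Rightarrow> schedule \<Rightarrow> bool" where
  "optimal I X \<longleftrightarrow> feasible I X \<and> (\<forall>Y. feasible I Y \<longrightarrow> cost I X \<le> cost I Y)"

definition truncate_inst :: "dc_instance \<Rightarrow> nat \<Rightarrow> dc_instance" where
  "truncate_inst I t = I\<lparr>slots := t\<rparr>"

definition expiring :: "dc_instance \<Rightarrow> nat \<Rightarrow> nat \<Rightarrow> nat set" where
  "expiring I t j =
     {u\<in>{1..t - 1}. (\<Sum>v=u+1..t-1. idle_cost I v j) \<le> switch_cost I j \<and>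
                    switch_cost I j < (\<Sum>v=u+1..t. idle_cost I v j)}"

text \<open>For a family \<open>Xh\<close> of schedules, where \<open>Xh t\<close> is the optimal schedule computed for the
  instance truncated at \<open>t\<close>, \<open>alg_state I Xh j t\<close> is the pair of the number of active servers
  of type \<open>j\<close> and the array \<open>w\<close> of numbers of servers powered up in each slot, after slot
  \<open>t\<close> has been processed. The types do not interact except through \<open>Xh\<close>.\<close>

primrec alg_state ::
  "dc_instance \<Rightarrow> (nat \<Rightarrow> schedule) \<Rightarrow> nat \<Rightarrow> nat \<Rightarrow> int \<times> (nat \<Rightarrow> int)" where
  "alg_state I Xh j 0 = (0, \<lambda>u. 0)"
| "alg_state I Xh j (Suc t) =
     (let (x, w) = alg_state I Xh j t;
          x' = x - (\<Sum>u\<in>expiring I (Suc t) j. w u);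
          xh = Xh (Suc t) (Suc t) j
      in if x' \<le> xh then (xh, w(Suc t := xh - x')) else (x', w))"

definition alg_B :: "dc_instance \<Rightarrow> (nat \<Rightarrow> schedule) \<Rightarrow> schedule" where
  "alg_B I Xh t j = (if t \<le> slots I then fst (alg_state I Xh j t) else 0)"

definition c_const :: "dc_instance \<Rightarrow> real" where
  "c_const I =
     (\<Sum>j=1..types I. Max ((\<lambda>t. idle_cost I t j / switch_cost I j) ` {1..slots I}))"

end

theory Submission
  imports Defs
begin

text \<open>Let \<open>OPT t\<close> be the optimal cost of the instance truncated at \<open>t\<close>. Cutting \<open>Xh t\<close> off after
  slot \<open>s\<close> gives a competitor for \<open>Xh s\<close>, so \<open>OPT t\<close> exceeds \<open>OPT s\<close> by at least what \<open>Xh t\<close> pays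
  in the slots \<open>s+1..t\<close>. This is used twice.

  With \<open>s = t - 1\<close> it shows that the operating costs of \<open>Xh t\<close> in slot \<open>t\<close> sum up to at most the
  optimum. By convexity, the algorithm, which never has fewer active servers than \<open>Xh t\<close> in slot
  \<open>t\<close>, pays at most this plus the idle costs of its own servers.

  Secondly, suppose the algorithm powers up servers of type \<open>j\<close> in slot \<open>t\<close>, and let \<open>s + 1\<close> be
  the earliest slot whose servers have not yet expired. Then \<open>Xh t\<close> has as many active
  servers as the algorithm, and each of them was either powered up in \<open>s+1..t\<close> or idled throughout,
  which costs at least \<open>\<beta>\<^sub>j\<close> either way. Inductively, the switching cost of the algorithm for each
  single type is at most the optimum. A server powered up in slot \<open>u\<close> incurs idle cost at most
  \<open>l\<^sub>u\<^sub>,\<^sub>j + \<beta>\<^sub>j\<close>, which gives the factor \<open>2 + max\<^sub>t l\<^sub>t\<^sub>,\<^sub>j / \<beta>\<^sub>j\<close> per type.\<close>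

section \<open>Costs slot by slot, and truncated instances\<close>

text \<open>The summand of \<open>cost\<close> for one slot. It does not depend on
  \<open>slots I\<close>, so the costs of a schedule in all truncated instances are partial sums of
  the same terms.\<close>

definition stage_cost :: "dc_instance \<Rightarrow> schedule \<Rightarrow> nat \<Rightarrow> ereal" where
  "stage_cost I X t = slot_cost I t (X t) +
     ereal (\<Sum>j=1..types I. switch_cost I j * real_of_int (max (X t j - X (t - 1) j) 0))"

lemma cost_truncate: "cost (truncate_inst I t) X = (\<Sum>v=1..t. stage_cost I X v)"
  by (simp add: cost_def stage_cost_def truncate_inst_def slot_cost_def distributions_def
      type_cost_def op_cost_def cong: if_cong)

lemma truncate_inst_slots: "truncate_inst I (slots I) = I"
  by (simp add: truncate_inst_def)

lemma feasible_truncate_iff: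
  "feasible (truncate_inst I t) X \<longleftrightarrow>
     (\<forall>v\<in>{1..t}. \<forall>j\<in>{1..types I}. 0 \<le> X v j \<and> X v j \<le> int (servers I j)) \<and>
     (\<forall>j\<in>{1..types I}. X 0 j = 0 \<and> X (t + 1) j = 0) \<and>
     (\<forall>v\<in>{1..t}. (\<Sum>j=1..types I. real_of_int (X v j) * capacity I j) \<ge> volume I v)"
  by (simp add: feasible_def is_schedule_def truncate_inst_def)

lemma valid_instanceD:
  assumes "valid_instance I" "j \<in> {1..types I}"
  shows "switch_cost I j > 0" "capacity I j > 0"
    and "t \<in> {1..slots I} \<Longrightarrow> volume I t \<ge> 0"
    and "t \<in> {1..slots I} \<Longrightarrow> convex_on {0..capacity I j} (op_fun I t j)"
    and "t \<in> {1..slots I} \<Longrightarrow> mono_on {0..capacity I j} (op_fun I t j)"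
    and "t \<in> {1..slots I} \<Longrightarrow> idle_cost I t j \<ge> 0"
  using assms unfolding valid_instance_def idle_cost_def by (simp_all add: less_imp_le)

section \<open>Operating cost compared with idle cost\<close>

lemma type_cost_ge_idle:
  assumes "valid_instance I" "j \<in> {1..types I}" "t \<in> {1..slots I}" "x \<ge> 0" "z \<ge> 0"
  shows "ereal (real_of_int x * idle_cost I t j) \<le> type_cost I t j x z"
proof (cases "x > 0 \<and> volume I t * z / real_of_int x \<le> capacity I j")
  case True
  have "volume I t * z / real_of_int x \<ge> 0"
    using valid_instanceD(3)[OF assms(1-3)] assms(5) True by simp
  then have "idle_cost I t j \<le> op_fun I t j (volume I t * z / real_of_int x)"
    unfolding idle_cost_def
    using True by (intro mono_onD[OF valid_instanceD(5)[OF assms(1-3)]]) auto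
  then show ?thesis
    using True by (simp add: type_cost_def op_cost_def mult_left_mono)
next
  case False
  then show ?thesis
    using assms(4) by (auto simp: type_cost_def op_cost_def)
qed

text \<open>Spreading the load of \<open>y\<close> servers over \<open>x\<close> servers scales the
  load per server by \<open>y / x\<close>, and convexity between 0 and the old load bounds the new
  cost. The surplus is \<open>x - y\<close> idle costs, rounded up to \<open>x\<close> because idle
  cost is later charged to every running server. For \<open>y = 0\<close> either there is no load or
  the right side is infinite.\<close>

lemma type_cost_le_add_idle:
  assumes "valid_instance I" "j \<in> {1..types I}" "t \<in> {1..slots I}" "0 \<le> y" "y \<le> x" "z \<ge> 0"
  shows "type_cost I t j x z \<le> type_cost I t j y z + ereal (real_of_int x * idle_cost I t j)"
proof -
  note v = valid_instanceD[OF assms(1,2)]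
  have vol: "volume I t * z \<ge> 0"
    using v(3)[OF assms(3)] assms(6) by simp
  have idle: "idle_cost I t j \<ge> 0"
    using v(6)[OF assms(3)] .
  show ?thesis
  proof (cases "y = 0")
    case True
    then show ?thesis
      using vol assms(5) v(2)
      by (cases "volume I t * z = 0") (auto simp: type_cost_def op_cost_def idle_cost_def)
  next
    case False
    then have y: "y > 0" and x: "x > 0"
      using assms by auto
    \<comment> \<open>\<open>q\<close> is the load per server with \<open>y\<close> servers,
      \<open>r * q\<close> the one with \<open>x\<close> servers.\<close>
    define q where "q = volume I t * z / real_of_int y"
    define r where "r = real_of_int y / real_of_int x"
    have q0: "q \<ge> 0"
      using vol y by (simp add: q_def)
    have r: "0 \<le> r" "r \<le> 1"
      using x y assms(5) by (auto simp: r_def)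
    have rq: "volume I t * z / real_of_int x = r * q"
      using x y by (simp add: q_def r_def)
    show ?thesis
    proof (cases "q \<le> capacity I j")
      case True
      have "op_fun I t j ((1 - r) *\<^sub>R 0 + r *\<^sub>R q) \<le> (1 - r) * op_fun I t j 0 + r * op_fun I t j q"
        using v(2) r q0 True by (intro convex_onD[OF v(4)[OF assms(3)]]) auto
      moreover have "(1 - r) * op_fun I t j 0 \<le> idle_cost I t j"
        using idle r by (simp add: idle_cost_def mult_left_le_one_le)
      ultimately have "op_fun I t j (r * q) \<le> idle_cost I t j + r * op_fun I t j q"
        by simp
      then have "real_of_int x * op_fun I t j (r * q)
          \<le> real_of_int x * (idle_cost I t j + r * op_fun I t j q)"
        using x by (intro mult_left_mono) auto
      also have "\<dots> = real_of_int y * op_fun I t j q + real_of_int x * idle_cost I t j"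
        using x by (simp add: r_def algebra_simps)
      finally have "real_of_int x * op_fun I t j (r * q)
          \<le> real_of_int y * op_fun I t j q + real_of_int x * idle_cost I t j" .
      moreover have "r * q \<le> capacity I j"
        using mult_right_mono[OF r(2) q0] True by simp
      ultimately show ?thesis
        using x y True by (simp add: type_cost_def op_cost_def rq flip: q_def)
    next
      case False
      then show ?thesis
        using y by (simp add: type_cost_def op_cost_def flip: q_def)
    qed
  qed
qed

lemma slot_cost_ge_idle:
  assumes "valid_instance I" "t \<in> {1..slots I}" "\<And>j. j \<in> {1..types I} \<Longrightarrow> x j \<ge> 0"
  shows "ereal (\<Sum>j=1..types I. real_of_int (x j) * idle_cost I t j) \<le> slot_cost I t x"
  unfolding slot_cost_def
proof (rule INF_greatest)
  fix z assume "z \<in> distributions I"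
  then have "ereal (real_of_int (x j) * idle_cost I t j) \<le> type_cost I t j (x j) (z j)"
    if "j \<in> {1..types I}" for j
    using that by (intro type_cost_ge_idle assms) (auto simp: distributions_def)
  then show "ereal (\<Sum>j=1..types I. real_of_int (x j) * idle_cost I t j)
      \<le> (\<Sum>j=1..types I. type_cost I t j (x j) (z j))"
    unfolding sum_ereal[symmetric] by (intro sum_mono) auto
qed

lemma slot_cost_le_add_idle:
  assumes "valid_instance I" "t \<in> {1..slots I}"
    and "\<And>j. j \<in> {1..types I} \<Longrightarrow> 0 \<le> y j \<and> y j \<le> x j"
  shows "slot_cost I t x \<le>
    slot_cost I t y + ereal (\<Sum>j=1..types I. real_of_int (x j) * idle_cost I t j)"
    (is "_ \<le> _ + ereal ?K")
proof -
  \<comment> \<open>Both configurations use the same distribution \<open>z\<close>. The finite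
    constant is moved to the left so that the bound passes to the infimum over
    \<open>z\<close>.\<close>
  have "slot_cost I t x - ereal ?K \<le> (\<Sum>j=1..types I. type_cost I t j (y j) (z j))"
    if z: "z \<in> distributions I" for z
  proof -
    have "slot_cost I t x \<le> (\<Sum>j=1..types I. type_cost I t j (x j) (z j))"
      unfolding slot_cost_def by (rule INF_lower[OF z])
    also have "\<dots> \<le> (\<Sum>j=1..types I. type_cost I t j (y j) (z j)
        + ereal (real_of_int (x j) * idle_cost I t j))"
      using z assms by (intro sum_mono type_cost_le_add_idle) (auto simp: distributions_def)
    also have "\<dots> = (\<Sum>j=1..types I. type_cost I t j (y j) (z j)) + ereal ?K"
      by (simp add: sum.distrib)
    finally show ?thesis
      by (simp add: ereal_minus_le)
  qed
  then have "slot_cost I t x - ereal ?K \<le> slot_cost I t y"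
    unfolding slot_cost_def[of I t y] by (rule INF_greatest)
  then show ?thesis
    by (simp add: ereal_minus_le)
qed

lemma slot_cost_nonneg:
  assumes "valid_instance I" "t \<in> {1..slots I}" "\<And>j. j \<in> {1..types I} \<Longrightarrow> x j \<ge> 0"
  shows "0 \<le> slot_cost I t x"
proof -
  have "0 \<le> (\<Sum>j=1..types I. real_of_int (x j) * idle_cost I t j)"
    using assms valid_instanceD(6)[OF assms(1)] by (intro sum_nonneg mult_nonneg_nonneg) auto
  then have "0 \<le> ereal (\<Sum>j=1..types I. real_of_int (x j) * idle_cost I t j)"
    by simp
  then show ?thesis
    using slot_cost_ge_idle[OF assms] by (rule order_trans)
qed

lemma stage_cost_ge_slot_cost:
  assumes "valid_instance I"
  shows "slot_cost I t (X t) \<le> stage_cost I X t"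
proof -
  have "0 \<le> (\<Sum>j=1..types I. switch_cost I j * real_of_int (max (X t j - X (t - 1) j) 0))"
    using valid_instanceD(1)[OF assms] by (intro sum_nonneg mult_nonneg_nonneg) (auto simp: less_imp_le)
  then show ?thesis
    unfolding stage_cost_def by (simp add: ereal_le_add_self)
qed

section \<open>Lower bounds from a single server type\<close>

text \<open>The operating cost does not split by type, since all types share one distribution.
  Replacing it by idle cost leaves a share that can be charged to type \<open>j\<close>
  alone.\<close>

definition single_type_cost :: "dc_instance \<Rightarrow> schedule \<Rightarrow> nat \<Rightarrow> nat \<Rightarrow> real" where
  "single_type_cost I X j t = real_of_int (X t j) * idle_cost I t j
     + switch_cost I j * real_of_int (max (X t j - X (t - 1) j) 0)"

lemma stage_cost_ge_single_type_cost:
  assumes "valid_instance I" "t \<in> {1..slots I}" "j \<in> {1..types I}"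
    and "\<And>j. j \<in> {1..types I} \<Longrightarrow> X t j \<ge> 0"
  shows "ereal (single_type_cost I X j t) \<le> stage_cost I X t"
proof -
  note v = valid_instanceD[OF assms(1)]
  have "single_type_cost I X j t \<le> (\<Sum>j=1..types I. single_type_cost I X j t)"
    using v(1) v(6)[OF _ assms(2)] assms(3,4)
    by (intro member_le_sum) (auto simp: single_type_cost_def less_imp_le)
  then have "ereal (single_type_cost I X j t) \<le>
      ereal (\<Sum>j=1..types I. real_of_int (X t j) * idle_cost I t j) +
      ereal (\<Sum>j=1..types I. switch_cost I j * real_of_int (max (X t j - X (t - 1) j) 0))"
    by (simp add: single_type_cost_def sum.distrib)
  also have "\<dots> \<le> stage_cost I X t"
    unfolding stage_cost_def using assms by (intro add_right_mono slot_cost_ge_idle) auto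
  finally show ?thesis .
qed

text \<open>Each server active at the end was either switched on during the interval or idled in all of
  its slots.\<close>

lemma single_type_cost_interval_ge:
  assumes "valid_instance I" "j \<in> {1..types I}" "s \<le> t" "t \<le> slots I"
    and "\<And>v. v \<in> {s+1..t} \<Longrightarrow> X v j \<ge> 0"
  shows "min (switch_cost I j) (\<Sum>v=s+1..t. idle_cost I v j) * real_of_int (X t j)
    \<le> (\<Sum>v=s+1..t. single_type_cost I X j v)"
  using assms(3,4,5)
proof (induction t rule: dec_induct)
  case base
  then show ?case
    using valid_instanceD(1)[OF assms(1,2)] by simp
next
  case (step n)
  define b where "b = switch_cost I j"
  define S where "S = (\<Sum>v=s+1..n. idle_cost I v j)"
  define l where "l = idle_cost I (Suc n) j"
  define x where "x = real_of_int (X n j)"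
  define x' where "x' = real_of_int (X (Suc n) j)"
  define F where "F = min b S"
  have l: "l \<ge> 0"
    unfolding l_def using step.prems by (intro valid_instanceD(6)[OF assms(1,2)]) auto
  have S: "S \<ge> 0"
    unfolding S_def using step.prems by (intro sum_nonneg valid_instanceD(6)[OF assms(1,2)]) auto
  have b: "b > 0"
    unfolding b_def by (rule valid_instanceD(1)[OF assms(1,2)])
  have x': "x' \<ge> 0"
    unfolding x'_def using step by simp
  have IH: "F * x \<le> (\<Sum>v=s+1..n. single_type_cost I X j v)"
    unfolding F_def b_def S_def x_def using step by simp
  have F: "0 \<le> F" "F \<le> b"
    using S b by (auto simp: F_def)
  \<comment> \<open>The rate \<open>F\<close> per server is at most \<open>b\<close>, so switching
    cost pays for an increase from \<open>x\<close> to \<open>x'\<close>. The rate itself grows by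
    at most \<open>l\<close>, which the idle cost of slot \<open>Suc n\<close> pays.\<close>
  have "F * (x' - x) \<le> F * max (x' - x) 0"
    using F by (intro mult_left_mono) auto
  also have "\<dots> \<le> b * max (x' - x) 0"
    using F by (intro mult_right_mono) auto
  finally have up: "F * (x' - x) \<le> b * max (x' - x) 0" .
  have "min b (S + l) * x' \<le> (F + l) * x'"
    using l x' by (intro mult_right_mono) (auto simp: F_def)
  also have "\<dots> = F * x + (x' * l + F * (x' - x))"
    by (simp add: algebra_simps)
  also have "\<dots> \<le> (\<Sum>v=s+1..n. single_type_cost I X j v) + single_type_cost I X j (Suc n)"
  proof -
    have "single_type_cost I X j (Suc n) = x' * l + b * max (x' - x) 0"
      by (simp add: single_type_cost_def x'_def l_def b_def x_def of_int_max)
    then show ?thesis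
      using IH up by linarith
  qed
  finally show ?case
    using step.hyps by (simp add: b_def S_def l_def x'_def)
qed

text \<open>Starting from no servers, every server active in slot \<open>t\<close> must have been
  switched on; the increments telescope.\<close>

lemma single_type_cost_initial_ge:
  assumes "valid_instance I" "j \<in> {1..types I}" "t \<le> slots I" "X 0 j = 0"
    and "\<And>v. v \<in> {1..t} \<Longrightarrow> X v j \<ge> 0"
  shows "switch_cost I j * real_of_int (X t j) \<le> (\<Sum>v=1..t. single_type_cost I X j v)"
  using assms(3,5)
proof (induction t)
  case 0
  then show ?case
    using assms(4) by simp
next
  case (Suc n)
  have "idle_cost I (Suc n) j \<ge> 0"
    using Suc.prems by (intro valid_instanceD(6)[OF assms(1,2)]) auto
  then have "0 \<le> real_of_int (X (Suc n) j) * idle_cost I (Suc n) j"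
    using Suc.prems by simp
  moreover have "switch_cost I j * (real_of_int (X (Suc n) j) - real_of_int (X n j))
      \<le> switch_cost I j * real_of_int (max (X (Suc n) j - X n j) 0)"
    using valid_instanceD(1)[OF assms(1,2)] by (intro mult_left_mono) auto
  moreover have "switch_cost I j * real_of_int (X n j) \<le> (\<Sum>v=1..n. single_type_cost I X j v)"
    using Suc by simp
  ultimately show ?case
    by (simp add: single_type_cost_def algebra_simps)
qed

section \<open>Bookkeeping of the algorithm\<close>

text \<open>Entry \<open>u\<close> of the array is written only in slot \<open>u\<close>, so reading
  it there gives its final value.\<close>

definition powered_up :: "dc_instance \<Rightarrow> (nat \<Rightarrow> schedule) \<Rightarrow> nat \<Rightarrow> nat \<Rightarrow> int" where
  "powered_up I Xh j u = snd (alg_state I Xh j u) u"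

definition alive :: "dc_instance \<Rightarrow> nat \<Rightarrow> nat \<Rightarrow> nat set" where
  "alive I t j = {u\<in>{1..t}. (\<Sum>v=u+1..t. idle_cost I v j) \<le> switch_cost I j}"

lemma snd_alg_state_future: "t < u \<Longrightarrow> snd (alg_state I Xh j t) u = 0"
  by (induction t) (auto simp: Let_def split: prod.splits)

lemma snd_alg_state: "u \<le> t \<Longrightarrow> snd (alg_state I Xh j t) u = powered_up I Xh j u"
proof (induction t)
  case 0
  then show ?case
    by (simp add: powered_up_def)
next
  case (Suc t)
  show ?case
  proof (cases "u = Suc t")
    case True
    then show ?thesis
      by (simp add: powered_up_def)
  next
    case False
    then show ?thesis
      using Suc by (auto simp: Let_def split: prod.splits)
  qed
qed

lemma alg_state_Suc:
  fixes I Xh j t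
  defines "x' \<equiv> fst (alg_state I Xh j t) - (\<Sum>u\<in>expiring I (Suc t) j. powered_up I Xh j u)"
  shows "powered_up I Xh j (Suc t) = max 0 (Xh (Suc t) (Suc t) j - x')"
    and "fst (alg_state I Xh j (Suc t)) = x' + powered_up I Xh j (Suc t)"
proof -
  obtain x w where xw: "alg_state I Xh j t = (x, w)"
    by fastforce
  have "w u = powered_up I Xh j u" if "u \<in> expiring I (Suc t) j" for u
    using snd_alg_state[of u t I Xh j] that xw by (auto simp: expiring_def)
  then have "x' = x - (\<Sum>u\<in>expiring I (Suc t) j. w u)"
    using xw by (simp add: x'_def)
  \<comment> \<open>If nothing is powered up, the array is not updated and the entry keeps its
    initial value.\<close>
  moreover have "w (Suc t) = 0"
    using snd_alg_state_future[of t "Suc t" I Xh j] xw by simp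
  ultimately show "powered_up I Xh j (Suc t) = max 0 (Xh (Suc t) (Suc t) j - x')"
    and "fst (alg_state I Xh j (Suc t)) = x' + powered_up I Xh j (Suc t)"
    by (auto simp: powered_up_def xw Let_def)
qed

lemma powered_up_nonneg: "powered_up I Xh j u \<ge> 0"
proof (cases u)
  case 0
  then show ?thesis
    by (simp add: powered_up_def)
next
  case (Suc t)
  then show ?thesis
    using alg_state_Suc(1)[of I Xh j t] by simp
qed

lemma alg_state_ge: "t \<ge> 1 \<Longrightarrow> fst (alg_state I Xh j t) \<ge> Xh t t j"
  using alg_state_Suc[of I Xh j "t - 1"] by simp

lemma alg_state_le_add_powered_up:
  "t \<ge> 1 \<Longrightarrow> fst (alg_state I Xh j t) \<le> fst (alg_state I Xh j (t - 1)) + powered_up I Xh j t"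
  using alg_state_Suc(2)[of I Xh j "t - 1"]
    sum_nonneg[of "expiring I t j" "powered_up I Xh j"] powered_up_nonneg[of I Xh j]
  by simp

lemma alg_state_powered_up:
  "t \<ge> 1 \<Longrightarrow> powered_up I Xh j t \<noteq> 0 \<Longrightarrow> fst (alg_state I Xh j t) = Xh t t j"
  using alg_state_Suc[of I Xh j "t - 1"] by (auto simp: max_def split: if_splits)

text \<open>The count grows only in slots with a power-up, and then it is raised exactly to
  \<open>Xh t t j\<close>.\<close>

lemma alg_state_le_servers:
  assumes "\<And>v. v \<in> {1..t} \<Longrightarrow> Xh v v j \<le> m" "0 \<le> m"
  shows "fst (alg_state I Xh j t) \<le> m"
  using assms(1)
proof (induction t)
  case 0
  then show ?case
    using assms(2) by simp
next
  case (Suc t)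
  then have "fst (alg_state I Xh j t) \<le> m" "Xh (Suc t) (Suc t) j \<le> m"
    by auto
  then show ?case
    using alg_state_le_add_powered_up[of "Suc t" I Xh j] alg_state_powered_up[of "Suc t" I Xh j]
    by fastforce
qed

text \<open>Idle costs are nonnegative, so a sum that has exceeded the switching cost stays above
  it: each slot expires at most once. The new slot is alive because its own sum is empty.\<close>

lemma alive_Suc:
  assumes "valid_instance I" "j \<in> {1..types I}" "Suc t \<le> slots I"
  shows "alive I (Suc t) j = insert (Suc t) (alive I t j - expiring I (Suc t) j)"
    and "expiring I (Suc t) j \<subseteq> alive I t j"
proof -
  have "idle_cost I (Suc t) j \<ge> 0"
    using assms(3) by (intro valid_instanceD(6)[OF assms(1,2)]) auto
  then show "alive I (Suc t) j = insert (Suc t) (alive I t j - expiring I (Suc t) j)"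
    using valid_instanceD(1)[OF assms(1,2)]
    by (auto simp: alive_def expiring_def le_Suc_eq)
  show "expiring I (Suc t) j \<subseteq> alive I t j"
    by (auto simp: alive_def expiring_def)
qed

lemma finite_alive: "finite (alive I t j)"
  by (simp add: alive_def)

lemma alg_state_eq_sum_alive:
  assumes "valid_instance I" "j \<in> {1..types I}" "t \<le> slots I"
  shows "fst (alg_state I Xh j t) = (\<Sum>u\<in>alive I t j. powered_up I Xh j u)"
  using assms(3)
proof (induction t)
  case 0
  then show ?case
    by (simp add: alive_def)
next
  case (Suc t)
  have "Suc t \<notin> alive I t j"
    by (simp add: alive_def)
  then show ?case
    using Suc alive_Suc[OF assms(1,2) Suc.prems] alg_state_Suc(2)[of I Xh j t]
    by (simp add: finite_alive sum_diff)
qed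

section \<open>Idle cost of the servers of the algorithm\<close>

text \<open>If \<open>m\<close> is the last slot in which \<open>u\<close> is alive, the idle costs
  of \<open>u+1..m\<close> sum to at most the switching cost. Slot \<open>u\<close> itself is
  outside that sum and contributes the extra term.\<close>

lemma sum_idle_alive_le:
  assumes "valid_instance I" "j \<in> {1..types I}" "u \<in> {1..slots I}"
  shows "(\<Sum>t | t \<in> {1..slots I} \<and> u \<in> alive I t j. idle_cost I t j)
    \<le> idle_cost I u j + switch_cost I j"
proof -
  let ?A = "{t. t \<in> {1..slots I} \<and> u \<in> alive I t j}"
  have u: "u \<in> ?A"
    using assms(3) valid_instanceD(1)[OF assms(1,2)] by (simp add: alive_def)
  define m where "m = Max ?A"
  have m: "m \<in> ?A"
    unfolding m_def using u by (intro Max_in) auto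
  have "?A \<subseteq> {u..m}"
  proof
    fix t assume t: "t \<in> ?A"
    then have "t \<le> m"
      unfolding m_def by (intro Max_ge) auto
    then show "t \<in> {u..m}"
      using t by (simp add: alive_def)
  qed
  then have "(\<Sum>t\<in>?A. idle_cost I t j) \<le> (\<Sum>t=u..m. idle_cost I t j)"
    using m assms(3) by (intro sum_mono2 valid_instanceD(6)[OF assms(1,2)]) auto
  also have "\<dots> = idle_cost I u j + (\<Sum>t=u+1..m. idle_cost I t j)"
    using m by (simp add: alive_def sum.atLeast_Suc_atMost)
  also have "\<dots> \<le> idle_cost I u j + switch_cost I j"
    using m by (simp add: alive_def)
  finally show ?thesis .
qed

text \<open>Double counting of the pairs of a slot \<open>t\<close> and a slot \<open>u\<close>
  alive in \<open>t\<close>: the idle cost is regrouped by the slot in which a server was powered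
  up.\<close>

lemma alg_idle_cost_le:
  assumes "valid_instance I" "j \<in> {1..types I}"
  shows "(\<Sum>t=1..slots I. real_of_int (fst (alg_state I Xh j t)) * idle_cost I t j)
    \<le> (\<Sum>u=1..slots I. real_of_int (powered_up I Xh j u) * (idle_cost I u j + switch_cost I j))"
proof -
  let ?T = "{1..slots I}"
  let ?w = "\<lambda>u. real_of_int (powered_up I Xh j u)"
  have "(\<Sum>t\<in>?T. real_of_int (fst (alg_state I Xh j t)) * idle_cost I t j)
      = (\<Sum>t\<in>?T. \<Sum>u | u \<in> ?T \<and> u \<in> alive I t j. ?w u * idle_cost I t j)"
  proof (rule sum.cong[OF refl])
    fix t assume t: "t \<in> ?T"
    have "{u. u \<in> ?T \<and> u \<in> alive I t j} = alive I t j"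
      using t by (auto simp: alive_def)
    then show "real_of_int (fst (alg_state I Xh j t)) * idle_cost I t j
        = (\<Sum>u | u \<in> ?T \<and> u \<in> alive I t j. ?w u * idle_cost I t j)"
      using t by (simp add: alg_state_eq_sum_alive[OF assms] sum_distrib_right)
  qed
  also have "\<dots> = (\<Sum>u\<in>?T. \<Sum>t | t \<in> ?T \<and> u \<in> alive I t j. ?w u * idle_cost I t j)"
    by (rule sum.swap_restrict) auto
  also have "\<dots> = (\<Sum>u\<in>?T. ?w u * (\<Sum>t | t \<in> ?T \<and> u \<in> alive I t j. idle_cost I t j))"
    by (simp add: sum_distrib_left)
  also have "\<dots> \<le> (\<Sum>u\<in>?T. ?w u * (idle_cost I u j + switch_cost I j))"
    using powered_up_nonneg by (intro sum_mono mult_left_mono sum_idle_alive_le assms) auto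
  finally show ?thesis .
qed

section \<open>Growth of the optimal cost with the horizon\<close>

locale truncated_optima =
  fixes I :: dc_instance and Xh :: "nat \<Rightarrow> schedule"
  assumes valid: "valid_instance I"
    and opt: "\<And>t. t \<in> {1..slots I} \<Longrightarrow> optimal (truncate_inst I t) (Xh t)"
begin

text \<open>By \<open>cost_truncate\<close> the optimal cost of the instance truncated at
  \<open>t\<close>. At \<open>t = 0\<close> the sum is empty, which starts the inductions at
  0.\<close>

definition OPT :: "nat \<Rightarrow> ereal" where
  "OPT t = (\<Sum>v=1..t. stage_cost I (Xh t) v)"

lemma Xh_feasible: "t \<in> {1..slots I} \<Longrightarrow> feasible (truncate_inst I t) (Xh t)"
  using opt by (simp add: optimal_def)

lemma Xh_nonneg: "t \<in> {1..slots I} \<Longrightarrow> v \<in> {1..t} \<Longrightarrow> j \<in> {1..types I} \<Longrightarrow> Xh t v j \<ge> 0"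
  using Xh_feasible by (simp add: feasible_truncate_iff)

lemma OPT_split:
  assumes "s \<le> t" "t \<in> {1..slots I}"
  shows "OPT s + (\<Sum>v=s+1..t. stage_cost I (Xh t) v) \<le> OPT t"
proof -
  have "OPT s \<le> (\<Sum>v=1..s. stage_cost I (Xh t) v)"
  proof (cases "s = 0")
    case True
    then show ?thesis
      by (simp add: OPT_def)
  next
    case False
    \<comment> \<open>Switching off everything after slot \<open>s\<close> meets the required final
      state, and powering down is free.\<close>
    define Y where "Y v j = (if v \<le> s then Xh t v j else 0)" for v j
    have "feasible (truncate_inst I s) Y"
      using Xh_feasible[OF assms(2)] assms(1) by (auto simp: feasible_truncate_iff Y_def)
    moreover have "optimal (truncate_inst I s) (Xh s)"
      using False assms by (intro opt) auto
    ultimately have "OPT s \<le> (\<Sum>v=1..s. stage_cost I Y v)"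
      by (simp add: optimal_def cost_truncate OPT_def)
    also have "\<dots> = (\<Sum>v=1..s. stage_cost I (Xh t) v)"
    proof (rule sum.cong[OF refl])
      fix v assume "v \<in> {1..s}"
      then have "Y v = Xh t v" "Y (v - 1) = Xh t (v - 1)"
        by (auto simp: Y_def fun_eq_iff)
      then show "stage_cost I Y v = stage_cost I (Xh t) v"
        by (simp add: stage_cost_def)
    qed
    finally show ?thesis .
  qed
  then have "OPT s + (\<Sum>v=s+1..t. stage_cost I (Xh t) v)
      \<le> (\<Sum>v=1..s. stage_cost I (Xh t) v) + (\<Sum>v=s+1..t. stage_cost I (Xh t) v)"
    by (rule add_right_mono)
  also have "\<dots> = OPT t"
    using assms(1) sum.ub_add_nat[of 1 s "stage_cost I (Xh t)" "t - s"] by (simp add: OPT_def)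
  finally show ?thesis .
qed

lemma OPT_slot_cost:
  assumes "Suc t \<le> slots I"
  shows "OPT t + slot_cost I (Suc t) (Xh (Suc t) (Suc t)) \<le> OPT (Suc t)"
proof -
  have "OPT t + slot_cost I (Suc t) (Xh (Suc t) (Suc t)) \<le> OPT t + stage_cost I (Xh (Suc t)) (Suc t)"
    by (intro add_left_mono stage_cost_ge_slot_cost valid)
  also have "\<dots> \<le> OPT (Suc t)"
    using OPT_split[of t "Suc t"] assms by simp
  finally show ?thesis .
qed

lemma sum_slot_cost_le_OPT: "t \<le> slots I \<Longrightarrow> (\<Sum>v=1..t. slot_cost I v (Xh v v)) \<le> OPT t"
proof (induction t)
  case 0
  then show ?case
    by (simp add: OPT_def)
next
  case (Suc t)
  then have "(\<Sum>v=1..Suc t. slot_cost I v (Xh v v))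
      \<le> OPT t + slot_cost I (Suc t) (Xh (Suc t) (Suc t))"
    by (simp add: add_right_mono)
  also have "\<dots> \<le> OPT (Suc t)"
    using Suc by (intro OPT_slot_cost) auto
  finally show ?case .
qed

lemma OPT_mono_Suc:
  assumes "Suc t \<le> slots I"
  shows "OPT t \<le> OPT (Suc t)"
proof -
  have "0 \<le> slot_cost I (Suc t) (Xh (Suc t) (Suc t))"
    using assms Xh_nonneg by (intro slot_cost_nonneg valid) auto
  then have "OPT t \<le> OPT t + slot_cost I (Suc t) (Xh (Suc t) (Suc t))"
    by (rule ereal_le_add_self)
  then show ?thesis
    using OPT_slot_cost[OF assms] by (rule order_trans)
qed

lemma OPT_single_type:
  assumes "s \<le> t" "t \<in> {1..slots I}" "j \<in> {1..types I}"
    and "B \<le> (\<Sum>v=s+1..t. single_type_cost I (Xh t) j v)"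
  shows "OPT s + ereal B \<le> OPT t"
proof -
  have "ereal B \<le> (\<Sum>v=s+1..t. ereal (single_type_cost I (Xh t) j v))"
    using assms(4) by simp
  also have "\<dots> \<le> (\<Sum>v=s+1..t. stage_cost I (Xh t) v)"
    using assms Xh_nonneg by (intro sum_mono stage_cost_ge_single_type_cost valid) auto
  finally have "OPT s + ereal B \<le> OPT s + (\<Sum>v=s+1..t. stage_cost I (Xh t) v)"
    by (rule add_left_mono)
  then show ?thesis
    using OPT_split[OF assms(1,2)] by (rule order_trans)
qed

section \<open>Switching cost of the algorithm for one type\<close>

text \<open>The induction is strong because a power-up in slot \<open>t\<close> is charged together
  with all power-ups in \<open>s+1..t\<close>, after which the hypothesis is used at
  \<open>s\<close>. Without a power-up in \<open>t\<close>, monotonicity of \<open>OPT\<close>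
  suffices.\<close>

lemma switching_le_OPT:
  assumes "j \<in> {1..types I}" "t \<le> slots I"
  shows "ereal (switch_cost I j * (\<Sum>u=1..t. real_of_int (powered_up I Xh j u))) \<le> OPT t"
  using assms(2)
proof (induction t rule: less_induct)
  case (less t)
  let ?w = "\<lambda>u. real_of_int (powered_up I Xh j u)"
  let ?b = "switch_cost I j"
  note v = valid_instanceD[OF valid assms(1)]
  show ?case
  proof (cases "t = 0")
    case True
    then show ?thesis
      by (simp add: OPT_def)
  next
    case t: False
    show ?thesis
    proof (cases "powered_up I Xh j t = 0")
      case True
      from t obtain n where n: "t = Suc n"
        by (cases t) auto
      have "ereal (?b * (\<Sum>u=1..n. ?w u)) \<le> OPT n"
        using less n by auto
      also have "\<dots> \<le> OPT t"
        using OPT_mono_Suc[of n] less.prems n by simp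
      finally show ?thesis
        using n True by simp
    next
      case False
      have tT: "t \<in> {1..slots I}"
        using t less.prems by auto
      define p where "p = Min (alive I t j)"
      define s where "s = p - 1"
      have ta: "t \<in> alive I t j"
        using t v(1) by (simp add: alive_def)
      then have pa: "p \<in> alive I t j"
        unfolding p_def by (intro Min_in finite_alive) auto
      have p: "p \<ge> 1" "p \<le> t" "s < t" "s + 1 = p"
        using pa by (auto simp: alive_def s_def)
      \<comment> \<open>The idle sum up to \<open>t\<close> shrinks as its starting slot grows, so
        no slot from \<open>p\<close> on has expired. Hence the active servers are exactly those
        powered up in \<open>s+1..t\<close>.\<close>
      have "alive I t j = {p..t}"
      proof (intro equalityI subsetI)
        fix u assume "u \<in> alive I t j"
        then show "u \<in> {p..t}"
          using finite_alive by (auto simp: p_def alive_def)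
      next
        fix u assume u: "u \<in> {p..t}"
        have "(\<Sum>v=u+1..t. idle_cost I v j) \<le> (\<Sum>v=p+1..t. idle_cost I v j)"
          using u p tT by (intro sum_mono2 v(6)) auto
        then show "u \<in> alive I t j"
          using pa u by (auto simp: alive_def)
      qed
      then have "real_of_int (fst (alg_state I Xh j t)) = (\<Sum>u=s+1..t. ?w u)"
        using alg_state_eq_sum_alive[OF valid assms(1) less.prems] p by simp
      then have xh: "(\<Sum>u=s+1..t. ?w u) = real_of_int (Xh t t j)"
        using alg_state_powered_up[of t I Xh j] t False by simp
      \<comment> \<open>For \<open>s = 0\<close> the schedule starts without servers. Otherwise slot
        \<open>s\<close> has expired, and the sum that decides this ranges exactly over
        \<open>s+1..t\<close>, so idling throughout costs more than \<open>?b\<close>.\<close>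
      have "?b * real_of_int (Xh t t j) \<le> (\<Sum>v=s+1..t. single_type_cost I (Xh t) j v)"
      proof (cases "s = 0")
        case True
        then show ?thesis
          using single_type_cost_initial_ge[OF valid assms(1) less.prems, of "Xh t"]
            Xh_feasible[OF tT] assms(1)
          by (simp add: feasible_truncate_iff)
      next
        case False
        have "s \<notin> alive I t j"
        proof
          assume "s \<in> alive I t j"
          then have "p \<le> s"
            unfolding p_def by (intro Min_le finite_alive)
          then show False
            using p by simp
        qed
        then have "?b < (\<Sum>v=s+1..t. idle_cost I v j)"
          using False p by (auto simp: alive_def)
        then show ?thesis
          using single_type_cost_interval_ge[OF valid assms(1) _ less.prems, of s "Xh t"]
            Xh_nonneg[OF tT _ assms(1)] p
          by simp
      qed
      then have "OPT s + ereal (?b * (\<Sum>u=s+1..t. ?w u)) \<le> OPT t"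
        using p tT assms(1) xh by (intro OPT_single_type) auto
      moreover have "ereal (?b * (\<Sum>u=1..s. ?w u)) + ereal (?b * (\<Sum>u=s+1..t. ?w u))
          \<le> OPT s + ereal (?b * (\<Sum>u=s+1..t. ?w u))"
        using less.IH[OF p(3)] less.prems p by (intro add_right_mono) auto
      moreover have "(\<Sum>u=1..t. ?w u) = (\<Sum>u=1..s. ?w u) + (\<Sum>u=s+1..t. ?w u)"
        using p sum.ub_add_nat[of 1 s ?w "t - s"] by simp
      ultimately show ?thesis
        by (auto simp: distrib_left intro: order_trans)
    qed
  qed
qed

section \<open>Feasibility and competitive ratio\<close>

text \<open>Capacity suffices because the algorithm never falls below the feasible state
  \<open>Xh t t\<close>.\<close>

lemma alg_B_feasible: "feasible I (alg_B I Xh)"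
proof -
  have ge: "Xh t t j \<le> alg_B I Xh t j" if "t \<in> {1..slots I}" for t j
    using that alg_state_ge by (simp add: alg_B_def)
  have le: "alg_B I Xh t j \<le> int (servers I j)" if "t \<in> {1..slots I}" "j \<in> {1..types I}" for t j
    using that Xh_feasible
    by (auto simp: alg_B_def feasible_truncate_iff intro!: alg_state_le_servers)
  have "volume I t \<le> (\<Sum>j=1..types I. real_of_int (alg_B I Xh t j) * capacity I j)"
    if t: "t \<in> {1..slots I}" for t
  proof -
    have "volume I t \<le> (\<Sum>j=1..types I. real_of_int (Xh t t j) * capacity I j)"
      using Xh_feasible[OF t] t by (simp add: feasible_truncate_iff)
    also have "\<dots> \<le> (\<Sum>j=1..types I. real_of_int (alg_B I Xh t j) * capacity I j)"
      using ge[OF t] valid_instanceD(2)[OF valid]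
      by (intro sum_mono mult_right_mono) (auto simp: less_imp_le)
    finally show ?thesis .
  qed
  moreover have "0 \<le> alg_B I Xh t j" if "t \<in> {1..slots I}" "j \<in> {1..types I}" for t j
    using ge[OF that(1), of j] Xh_nonneg[of t t j] that by simp
  ultimately show ?thesis
    using le by (auto simp: feasible_def is_schedule_def alg_B_def)
qed

text \<open>\<open>powered_up\<close> is a gross count: servers expiring in the same slot are not
  set off against it, so it bounds the net increase.\<close>

lemma alg_B_stage_cost_le:
  assumes "t \<in> {1..slots I}"
  shows "stage_cost I (alg_B I Xh) t \<le> slot_cost I t (Xh t t) +
    ereal (\<Sum>j=1..types I. real_of_int (fst (alg_state I Xh j t)) * idle_cost I t j
      + switch_cost I j * real_of_int (powered_up I Xh j t))"
proof -
  let ?x = "\<lambda>j. real_of_int (fst (alg_state I Xh j t))"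
  have B: "alg_B I Xh t j = fst (alg_state I Xh j t)"
    "alg_B I Xh (t - 1) j = fst (alg_state I Xh j (t - 1))" for j
    using assms by (auto simp: alg_B_def)
  have "slot_cost I t (alg_B I Xh t) \<le>
      slot_cost I t (Xh t t) + ereal (\<Sum>j=1..types I. ?x j * idle_cost I t j)"
    using slot_cost_le_add_idle[OF valid assms, of "Xh t t" "alg_B I Xh t"] assms
      Xh_nonneg alg_state_ge[of t] by (simp add: B)
  moreover have "(\<Sum>j=1..types I. switch_cost I j *
        real_of_int (max (alg_B I Xh t j - alg_B I Xh (t - 1) j) 0))
      \<le> (\<Sum>j=1..types I. switch_cost I j * real_of_int (powered_up I Xh j t))"
  proof (intro sum_mono mult_left_mono)
    fix j assume j: "j \<in> {1..types I}"
    show "real_of_int (max (alg_B I Xh t j - alg_B I Xh (t - 1) j) 0)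
        \<le> real_of_int (powered_up I Xh j t)"
      using alg_state_le_add_powered_up[of t I Xh j] powered_up_nonneg[of I Xh j t] assms
      unfolding B by simp
    show "0 \<le> switch_cost I j"
      using valid_instanceD(1)[OF valid j] by simp
  qed
  ultimately have "stage_cost I (alg_B I Xh) t \<le>
      (slot_cost I t (Xh t t) + ereal (\<Sum>j=1..types I. ?x j * idle_cost I t j))
      + ereal (\<Sum>j=1..types I. switch_cost I j * real_of_int (powered_up I Xh j t))"
    unfolding stage_cost_def by (intro add_mono) auto
  then show ?thesis
    by (simp add: sum.distrib add.assoc)
qed

definition max_idle_ratio :: "nat \<Rightarrow> real" where
  "max_idle_ratio j = Max ((\<lambda>t. idle_cost I t j / switch_cost I j) ` {1..slots I})"

lemma idle_cost_le_ratio: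
  assumes "t \<in> {1..slots I}" "j \<in> {1..types I}"
  shows "idle_cost I t j \<le> max_idle_ratio j * switch_cost I j"
proof -
  have "idle_cost I t j / switch_cost I j \<le> max_idle_ratio j"
    unfolding max_idle_ratio_def using assms(1) by (intro Max_ge) auto
  then show ?thesis
    using valid_instanceD(1)[OF valid assms(2)] by (simp add: field_simps)
qed

lemma max_idle_ratio_nonneg:
  assumes "j \<in> {1..types I}"
  shows "max_idle_ratio j \<ge> 0"
proof -
  have one: "1 \<in> {1..slots I}"
    using valid by (simp add: valid_instance_def)
  have "0 \<le> max_idle_ratio j * switch_cost I j"
    using idle_cost_le_ratio[OF one assms] valid_instanceD(6)[OF valid assms one] by linarith
  then show ?thesis
    using valid_instanceD(1)[OF valid assms] by (simp add: zero_le_mult_iff)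
qed

text \<open>Each power-up is charged its switching cost, idle cost up to another switching cost, and
  the idle cost of its first slot, which \<open>max_idle_ratio\<close> bounds.\<close>

lemma alg_type_cost_le:
  assumes "j \<in> {1..types I}"
  shows "(\<Sum>t=1..slots I. real_of_int (fst (alg_state I Xh j t)) * idle_cost I t j
      + switch_cost I j * real_of_int (powered_up I Xh j t))
    \<le> (2 + max_idle_ratio j) *
       (switch_cost I j * (\<Sum>t=1..slots I. real_of_int (powered_up I Xh j t)))"
proof -
  let ?w = "\<lambda>t. real_of_int (powered_up I Xh j t)"
  let ?b = "switch_cost I j"
  have "(\<Sum>t=1..slots I. real_of_int (fst (alg_state I Xh j t)) * idle_cost I t j + ?b * ?w t)
      \<le> (\<Sum>t=1..slots I. ?w t * (idle_cost I t j + ?b) + ?b * ?w t)"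
    using alg_idle_cost_le[OF valid assms, of Xh] by (simp add: sum.distrib)
  also have "\<dots> \<le> (\<Sum>t=1..slots I. ?w t * (max_idle_ratio j * ?b + ?b) + ?b * ?w t)"
    using idle_cost_le_ratio assms powered_up_nonneg
    by (intro sum_mono add_right_mono mult_left_mono) auto
  also have "\<dots> = (\<Sum>t=1..slots I. (2 + max_idle_ratio j) * (?b * ?w t))"
    by (rule sum.cong) (auto simp: algebra_simps)
  finally show ?thesis
    by (simp add: sum_distrib_left)
qed

text \<open>One \<open>OPT\<close> pays for the operating costs of the states \<open>Xh t t\<close>.
  Each type then adds its own multiple of the whole \<open>OPT\<close>, which is where the factor
  \<open>d\<close> arises.\<close>

lemma alg_B_cost_le:
  "cost I (alg_B I Xh) \<le> ereal (2 * real (types I) + 1 + c_const I) * OPT (slots I)"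
proof -
  let ?T = "slots I" and ?d = "types I"
  let ?h = "\<lambda>t j. real_of_int (fst (alg_state I Xh j t)) * idle_cost I t j
      + switch_cost I j * real_of_int (powered_up I Xh j t)"
  let ?r = "\<lambda>j. 2 + max_idle_ratio j"
  let ?S = "\<lambda>j. switch_cost I j * (\<Sum>t=1..?T. real_of_int (powered_up I Xh j t))"
  have "cost I (alg_B I Xh) = (\<Sum>t=1..?T. stage_cost I (alg_B I Xh) t)"
    using cost_truncate[of I ?T] by (simp add: truncate_inst_slots)
  also have "\<dots> \<le> (\<Sum>t=1..?T. slot_cost I t (Xh t t) + ereal (\<Sum>j=1..?d. ?h t j))"
    by (intro sum_mono alg_B_stage_cost_le)
  also have "\<dots> = (\<Sum>t=1..?T. slot_cost I t (Xh t t)) + ereal (\<Sum>t=1..?T. \<Sum>j=1..?d. ?h t j)"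
    by (simp add: sum.distrib)
  also have "(\<Sum>t=1..?T. \<Sum>j=1..?d. ?h t j) = (\<Sum>j=1..?d. \<Sum>t=1..?T. ?h t j)"
    by (rule sum.swap)
  also have "(\<Sum>t=1..?T. slot_cost I t (Xh t t)) + ereal \<dots> \<le> OPT ?T + (\<Sum>j=1..?d. ereal (?r j) * OPT ?T)"
  proof (rule add_mono)
    show "(\<Sum>t=1..?T. slot_cost I t (Xh t t)) \<le> OPT ?T"
      by (rule sum_slot_cost_le_OPT) simp
    have "ereal (\<Sum>t=1..?T. ?h t j) \<le> ereal (?r j) * OPT ?T" if j: "j \<in> {1..?d}" for j
    proof -
      have "ereal (\<Sum>t=1..?T. ?h t j) \<le> ereal (?r j) * ereal (?S j)"
        using alg_type_cost_le[OF j] by simp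
      also have "\<dots> \<le> ereal (?r j) * OPT ?T"
        using switching_le_OPT[OF j] max_idle_ratio_nonneg[OF j]
        by (intro ereal_mult_left_mono) auto
      finally show ?thesis .
    qed
    then show "ereal (\<Sum>j=1..?d. \<Sum>t=1..?T. ?h t j) \<le> (\<Sum>j=1..?d. ereal (?r j) * OPT ?T)"
      unfolding sum_ereal[symmetric] by (intro sum_mono) auto
  qed
  \<comment> \<open>Nonnegative coefficients make the distributive laws valid in
    \<open>ereal\<close> whatever the value of \<open>OPT\<close>.\<close>
  also have "(\<Sum>j=1..?d. ereal (?r j) * OPT ?T) = ereal (\<Sum>j=1..?d. ?r j) * OPT ?T"
    using max_idle_ratio_nonneg
    by (subst sum_ereal[symmetric], subst sum_ereal_left_distrib) auto
  also have "OPT ?T + \<dots> = ereal (1 + (\<Sum>j=1..?d. ?r j)) * OPT ?T"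
  proof -
    have "0 \<le> (\<Sum>j=1..?d. ?r j)"
      using max_idle_ratio_nonneg by (intro sum_nonneg) auto
    then show ?thesis
      using ereal_left_distrib[of 1 "ereal (\<Sum>j=1..?d. ?r j)" "OPT ?T"] by (simp add: one_ereal_def)
  qed
  also have "1 + (\<Sum>j=1..?d. ?r j) = 2 * real ?d + 1 + c_const I"
    by (simp add: sum.distrib c_const_def max_idle_ratio_def)
  finally show ?thesis .
qed

lemma OPT_slots_le_cost:
  assumes "feasible I Y"
  shows "OPT (slots I) \<le> cost I Y"
proof -
  have "slots I \<in> {1..slots I}"
    using valid by (simp add: valid_instance_def)
  from opt[OF this] show ?thesis
    using assms cost_truncate[of I "slots I"]
    by (simp add: OPT_def truncate_inst_slots optimal_def)
qed

lemma c_const_nonneg: "c_const I \<ge> 0"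
  using max_idle_ratio_nonneg unfolding c_const_def max_idle_ratio_def by (intro sum_nonneg) auto

end

theorem theorem13:
  fixes I :: dc_instance and Xh :: "nat \<Rightarrow> schedule" and Xstar :: schedule
  assumes "valid_instance I"
    and "\<And>t. t \<in> {1..slots I} \<Longrightarrow> optimal (truncate_inst I t) (Xh t)"
    and "optimal I Xstar"
  shows "feasible I (alg_B I Xh) \<and>
    cost I (alg_B I Xh) \<le> ereal (2 * real (types I) + 1 + c_const I) * cost I Xstar"
proof -
  interpret truncated_optima I Xh
    using assms(1,2) by unfold_locales
  have "ereal (2 * real (types I) + 1 + c_const I) * OPT (slots I)
      \<le> ereal (2 * real (types I) + 1 + c_const I) * cost I Xstar"
    using OPT_slots_le_cost[of Xstar] assms(3) c_const_nonneg
    by (intro ereal_mult_left_mono) (auto simp: optimal_def)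
  then show ?thesis
    using alg_B_feasible alg_B_cost_le by (auto intro: order_trans)
qed

end
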